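(* Let $\{x_k\}_{k\in\mathcal S}$ be the accepted iterates of the adaptive prox-convex algorithm described in the context. Assume $F$ is proper, closed and bounded below, that $\{x_k\}_{k\in\mathcal S}$ is bounded, and that for all accepted $k$ and all $x\in\operatorname{dom}F$, $$-\frac{L_L}{2}\|x-x_k\|^2\ \le\ F(x)-F(x;x_k)\ \le\ \frac{L_U}{2}\|x-x_k\|^2,\qquad L_U:=L_h\beta_C+L_R^2\beta_s,\quad L_L:=L_U+L_s\beta_R .$$ Then every cluster point $\bar x$ of $\{x_k\}_{k\in\mathcal S}$ is first-order stationary: $0\in\partial F(\bar x)$.
   Context: **Problem.** $F(x)=g(x)+h(C(x))+s(R(x))$ on $\mathbb R^m$, where $g:\mathbb R^m\to\mathbb R\cup\{+\infty\}$ is proper, closed, convex; $h:\mathbb R^d\to\mathbb R$ is finite-valued, closed, convex; $C:\mathbb R^m\to\mathbb R^d$ and $s:\mathbb R^n\to\mathbb R$ are $\mathcal C^1$; $R=(r_1,\dots,r_n)$ with each $r_i:\mathbb R^m\to\mathbb R$ finite-valued, closed, convex. $\partial F$ is the limiting (Mordukhovich) subdifferential. $\|\cdot\|$ is the Euclidean norm on vectors and the spectral norm on matrices; $\|u\|_Q^2:=u^\top Qu$. **Standing assumptions.** (1) Monotone-or-smooth: for each $\bar x\in\operatorname{dom}F$ there is a neighborhood $W$ of $R(\bar x)$ such that, for every $i$, if $r_i$ is not $\mathcal C^1$ on any neighborhood of $\bar x$ then $\nabla_i s(z)\ge0$ for all $z\in W$. (2) $x_0\in\operatorname{dom}F$ and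 $\mathcal X_0:=\{x\in\operatorname{dom}F: F(x)\le F(x_0)\}$ is nonempty and compact. (3) $h$ is $L_h$-Lipschitz; $C$ has $\beta_C$-Lipschitz Jacobian; $s$ has $\beta_s$-Lipschitz gradient; each $r_i$ is $L_{r_i}$-Lipschitz, and $L_R:=\|(L_{r_1},\dots,L_{r_n})\|_2$. (4) Let $\mathcal I^-$ be the set of indices $i$ with $\nabla_i s(R(x))<0$ for some $x\in\mathcal X_0$. If $\mathcal I^-\ne\emptyset$, then $\|\nabla s(y)\|\le L_s$ for all $y\in\{R(x):F(x)\le F(x_0)\}$, and each $r_i$, $i\in\mathcal I^-$, is $\mathcal C^1$ with $\beta_{r_i}$-Lipschitz gradient; $\beta_R:=(\sum_{i\in\mathcal I^-}\beta_{r_i}^2)^{1/2}$. If $\mathcal I^-=\emptyset$, then $\beta_R=0$ and $L_s\beta_R$ is read as $0$. **Model.** For $x_k\in\mathcal X_0$, $$F(x;x_k)=g(x)+h\big(C(x_k)+\nabla C(x_k)(x-x_k)\big)+s(R(x_k))+\sum_{i=1}^n\nabla_i s(R(x_k))\,\Phi_i(x;x_k),$$ where $\Phi_i(x;x_k)=r_i(x)-r_i(x_k)$ if $\nabla_i s(R(x_k))\ge0$, and $\Phi_i(x;x_k)=\nabla r_i(x_k)^\top(x-x_k)$ if $\nabla_i s(R(x_k))<0$. $F(\cdot;x_k)$ is convex. The proximal model is $F_{Q}(x;x_k)=F(x;x_k)+\tfrac12\|x-x_k\|_{Q}^2$. **Curvature block.** $H_k^+:=\Pi_{\mathbb S_+}(H_{C,k}+H_{s,k})$,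 where $\Pi_{\mathbb S_+}$ is the (Frobenius) projection onto the cone of symmetric positive semidefinite matrices. Here $H_{C,k}=\sum_{j=1}^d y_j\nabla^2C_j(x_k)$ with some $y\in\partial h(C(x_k))$ if $C$ is $\mathcal C^2$ (and its Hessians are used), and $H_{C,k}=0$ otherwise. If $s$ is $\mathcal C^2$ (and its Hessian is used), $H_{s,k}=G_R(x_k)^\top\nabla^2s(R(x_k))G_R(x_k)+\sum_i\nabla_is(R(x_k))\nabla^2r_i(x_k)$, where $G_R(x_k)$ has rows $g_{i,k}^\top$ with $g_{i,k}\in\partial r_i(x_k)$ and the sum is over indices $i$ with $\nabla_is(R(x_k))<0$ and $r_i\in\mathcal C^2$ (whose Hessian is used); otherwise $H_{s,k}=0$. **Algorithm.** Input $x_0$, $\mu_0>0$, $\mu_{\min}>0$, $0<\alpha_1<\alpha_2<1$, $\nu_{\rm inc}>1>\nu_{\rm dec}>0$, tolerance $\epsilon_{\rm term}\ge0$. For $k=0,1,2,\dots$: build $H_k^+\succeq0$. Repeat: set $Q_k=\mu_kI+H_k^+$; $x_k^+=\arg\min_xF_{Q_k}(x;x_k)$; $\mathrm{Pred}_k=F(x_k)-F_{Q_k}(x_k^+;x_k)$; $\mathrm{Act}_k=F(x_k)-F(x_k^+)$; if $\mathrm{Pred}_k=0$ or $\|Q_k(x_k-x_k^+)\|\le\epsilon_{\rm term}$, terminate and return $x_k$; set $\rho_k=\mathrm{Act}_k/\mathrm{Pred}_k$; if $\rho_k<\alpha_1$ (rejection), set $\mu_k\leftarrow\nu_{\rm inc}\mu_k$;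 until $\rho_k\ge\alpha_1$ (acceptance). Then $x_{k+1}=x_k^+$, and $\mu_{k+1}=\max\{\mu_{\min},\nu_{\rm dec}\mu_k\}$ if $\rho_k>\alpha_2$, $\mu_{k+1}=\mu_k$ otherwise. $\mathcal S\subset\mathbb N$ is the set of accepted indices, i.e. indices $k$ for which a step from $x_k$ to $x_{k+1}$ is accepted. Cluster points are limits of $x_{k_i}$ along infinite subsequences $k_i\in\mathcal S$. *)

theory Defs
  imports "HOL-Analysis.Analysis"
begin

definition domain :: "('a \<Rightarrow> ereal) \<Rightarrow> 'a set" where
  "domain f = {x. f x < \<infinity>}"

definition proper_fun :: "('a \<Rightarrow> ereal) \<Rightarrow> bool" where
  "proper_fun f \<longleftrightarrow> (\<exists>x. f x < \<infinity>) \<and> (\<forall>x. - \<infinity> < f x)"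

definition ereal_epigraph :: "('a \<Rightarrow> ereal) \<Rightarrow> ('a \<times> real) set" where
  "ereal_epigraph f = {(x, t). f x \<le> ereal t}"

definition closed_fun :: "('a::topological_space \<Rightarrow> ereal) \<Rightarrow> bool" where
  "closed_fun f \<longleftrightarrow> closed (ereal_epigraph f)"

definition convex_fun :: "('a::real_vector \<Rightarrow> ereal) \<Rightarrow> bool" where
  "convex_fun f \<longleftrightarrow> convex (ereal_epigraph f)"

definition sublevel :: "('a \<Rightarrow> ereal) \<Rightarrow> 'a \<Rightarrow> 'a set" where
  "sublevel f x0 = {x \<in> domain f. f x \<le> f x0}"

definition frechet_subdiff :: "('a::real_inner \<Rightarrow> ereal) \<Rightarrow> 'a \<Rightarrow> 'a set" where
  "frechet_subdiff f x = {v. \<bar>f x\<bar> \<noteq> \<infinity> \<and>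
     0 \<le> Liminf (at x) (\<lambda>y. (f y - f x - ereal (v \<bullet> (y - x))) / ereal (norm (y - x)))}"

text \<open>The limiting (Mordukhovich) subdifferential. It is also used, via \<open>\<lambda>x. ereal (f x)\<close>, for
  finite convex functions, where it agrees with the subdifferential of convex analysis.\<close>

definition limiting_subdiff :: "('a::real_inner \<Rightarrow> ereal) \<Rightarrow> 'a \<Rightarrow> 'a set" where
  "limiting_subdiff f x = {v. \<bar>f x\<bar> \<noteq> \<infinity> \<and>
     (\<exists>X V. X \<longlonglongrightarrow> x \<and> (\<lambda>n. f (X n)) \<longlonglongrightarrow> f x \<and> V \<longlonglongrightarrow> v \<and>
        (\<forall>n. V n \<in> frechet_subdiff f (X n)))}"

text \<open>Both notions are meant for open \<open>U\<close>. Continuity of the derivative is continuity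
  in the operator norm.\<close>

definition C1_on :: "'a::real_normed_vector set \<Rightarrow> ('a \<Rightarrow> 'b::real_normed_vector) \<Rightarrow> bool" where
  "C1_on U f \<longleftrightarrow> (\<exists>f'. (\<forall>x\<in>U. (f has_derivative blinfun_apply (f' x)) (at x)) \<and> continuous_on U f')"

definition C2_on :: "'a::real_normed_vector set \<Rightarrow> ('a \<Rightarrow> 'b::real_normed_vector) \<Rightarrow> bool" where
  "C2_on U f \<longleftrightarrow> (\<exists>f'. (\<forall>x\<in>U. (f has_derivative blinfun_apply (f' x)) (at x)) \<and> C1_on U f')"

definition grad :: "('a::real_inner \<Rightarrow> real) \<Rightarrow> 'a \<Rightarrow> 'a" where
  "grad f x = (THE D. GDERIV f x :> D)"

definition hessian :: "(real^'m \<Rightarrow> real) \<Rightarrow> real^'m \<Rightarrow> real^'m^'m" where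
  "hessian f x = jacobian (grad f) (at x)"

text \<open>The norm of the type \<open>real^'m^'d\<close> is the Frobenius norm, hence a separate spectral norm.\<close>

definition spectral_norm :: "real^'m^'d \<Rightarrow> real" where
  "spectral_norm A = onorm (\<lambda>v. A *v v)"

definition psd_cone :: "(real^'m^'m) set" where
  "psd_cone = {A. transpose A = A \<and> (\<forall>v. 0 \<le> v \<bullet> (A *v v))}"

definition Rmap :: "('n \<Rightarrow> real^'m \<Rightarrow> real) \<Rightarrow> real^'m \<Rightarrow> real^'n" where
  "Rmap r x = (\<chi> i. r i x)"

definition objective ::
  "(real^'m \<Rightarrow> ereal) \<Rightarrow> (real^'d \<Rightarrow> real) \<Rightarrow> (real^'m \<Rightarrow> real^'d) \<Rightarrow> (real^'n \<Rightarrow> real) \<Rightarrow>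
   ('n \<Rightarrow> real^'m \<Rightarrow> real) \<Rightarrow> real^'m \<Rightarrow> ereal" where
  "objective g h C s r x = g x + ereal (h (C x)) + ereal (s (Rmap r x))"

definition neg_indices ::
  "(real^'m \<Rightarrow> ereal) \<Rightarrow> (real^'d \<Rightarrow> real) \<Rightarrow> (real^'m \<Rightarrow> real^'d) \<Rightarrow> (real^'n \<Rightarrow> real) \<Rightarrow>
   ('n \<Rightarrow> real^'m \<Rightarrow> real) \<Rightarrow> real^'m \<Rightarrow> 'n set" where
  "neg_indices g h C s r x0 =
     {i. \<exists>x\<in>sublevel (objective g h C s r) x0. grad s (Rmap r x) $ i < 0}"

definition Phi ::
  "(real^'n \<Rightarrow> real) \<Rightarrow> ('n \<Rightarrow> real^'m \<Rightarrow> real) \<Rightarrow> real^'m \<Rightarrow> 'n \<Rightarrow> real^'m \<Rightarrow> real" where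
  "Phi s r xk i x =
     (if 0 \<le> grad s (Rmap r xk) $ i then r i x - r i xk else grad (r i) xk \<bullet> (x - xk))"

definition model ::
  "(real^'m \<Rightarrow> ereal) \<Rightarrow> (real^'d \<Rightarrow> real) \<Rightarrow> (real^'m \<Rightarrow> real^'d) \<Rightarrow> (real^'n \<Rightarrow> real) \<Rightarrow>
   ('n \<Rightarrow> real^'m \<Rightarrow> real) \<Rightarrow> real^'m \<Rightarrow> real^'m \<Rightarrow> ereal" where
  "model g h C s r xk x =
     g x + ereal (h (C xk + jacobian C (at xk) *v (x - xk)))
         + ereal (s (Rmap r xk))
         + ereal (\<Sum>i\<in>UNIV. grad s (Rmap r xk) $ i * Phi s r xk i x)"

definition prox_model ::
  "(real^'m \<Rightarrow> ereal) \<Rightarrow> (real^'d \<Rightarrow> real) \<Rightarrow> (real^'m \<Rightarrow> real^'d) \<Rightarrow> (real^'n \<Rightarrow> real) \<Rightarrow>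
   ('n \<Rightarrow> real^'m \<Rightarrow> real) \<Rightarrow> real^'m^'m \<Rightarrow> real^'m \<Rightarrow> real^'m \<Rightarrow> ereal" where
  "prox_model g h C s r Q xk x =
     model g h C s r xk x + ereal (1/2 * ((x - xk) \<bullet> (Q *v (x - xk))))"

text \<open>Hessians of \<open>C^2\<close> components may be used or not, and the subgradients are free choices,
  so there is a set of admissible blocks at each point; \<open>0\<close> is the choice of not using
  the Hessians. In \<open>s_blocks\<close>, \<open>J\<close> collects the \<open>r i\<close> whose Hessian is used.\<close>

definition C_blocks :: "(real^'d \<Rightarrow> real) \<Rightarrow> (real^'m \<Rightarrow> real^'d) \<Rightarrow> real^'m \<Rightarrow> (real^'m^'m) set" where
  "C_blocks h C xk = {0} \<union>
     {(\<Sum>j\<in>UNIV. y $ j *\<^sub>R hessian (\<lambda>x. C x $ j) xk) | y.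
        C2_on UNIV C \<and> y \<in> limiting_subdiff (\<lambda>z. ereal (h z)) (C xk)}"

definition s_blocks ::
  "(real^'n \<Rightarrow> real) \<Rightarrow> ('n \<Rightarrow> real^'m \<Rightarrow> real) \<Rightarrow> real^'m \<Rightarrow> (real^'m^'m) set" where
  "s_blocks s r xk = {0} \<union>
     {transpose G ** hessian s (Rmap r xk) ** G
        + (\<Sum>i\<in>J. grad s (Rmap r xk) $ i *\<^sub>R hessian (r i) xk) | G J.
        C2_on UNIV s \<and>
        (\<forall>i. row i G \<in> limiting_subdiff (\<lambda>z. ereal (r i z)) xk) \<and>
        J \<subseteq> {i. grad s (Rmap r xk) $ i < 0 \<and> C2_on UNIV (r i)}}"

text \<open>The metric of \<open>real^'m^'m\<close> is the Frobenius one, so \<open>closest_point\<close> is the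
  Frobenius projection.\<close>

definition curvature_blocks ::
  "(real^'d \<Rightarrow> real) \<Rightarrow> (real^'m \<Rightarrow> real^'d) \<Rightarrow> (real^'n \<Rightarrow> real) \<Rightarrow>
   ('n \<Rightarrow> real^'m \<Rightarrow> real) \<Rightarrow> real^'m \<Rightarrow> (real^'m^'m) set" where
  "curvature_blocks h C s r xk =
     {closest_point psd_cone (HC + Hs) | HC Hs. HC \<in> C_blocks h C xk \<and> Hs \<in> s_blocks s r xk}"

definition prox_matrix :: "real \<Rightarrow> real^'m^'m \<Rightarrow> real^'m^'m" where
  "prox_matrix mu H = mu *\<^sub>R mat 1 + H"

definition is_trial ::
  "(real^'m \<Rightarrow> ereal) \<Rightarrow> (real^'d \<Rightarrow> real) \<Rightarrow> (real^'m \<Rightarrow> real^'d) \<Rightarrow> (real^'n \<Rightarrow> real) \<Rightarrow>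
   ('n \<Rightarrow> real^'m \<Rightarrow> real) \<Rightarrow> real^'m^'m \<Rightarrow> real^'m \<Rightarrow> real^'m \<Rightarrow> bool" where
  "is_trial g h C s r Q xk xp \<longleftrightarrow> is_arg_min (prox_model g h C s r Q xk) (\<lambda>_. True) xp"

definition Pred ::
  "(real^'m \<Rightarrow> ereal) \<Rightarrow> (real^'d \<Rightarrow> real) \<Rightarrow> (real^'m \<Rightarrow> real^'d) \<Rightarrow> (real^'n \<Rightarrow> real) \<Rightarrow>
   ('n \<Rightarrow> real^'m \<Rightarrow> real) \<Rightarrow> real^'m^'m \<Rightarrow> real^'m \<Rightarrow> real^'m \<Rightarrow> ereal" where
  "Pred g h C s r Q xk xp = objective g h C s r xk - prox_model g h C s r Q xk xp"

definition Act ::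
  "(real^'m \<Rightarrow> ereal) \<Rightarrow> (real^'d \<Rightarrow> real) \<Rightarrow> (real^'m \<Rightarrow> real^'d) \<Rightarrow> (real^'n \<Rightarrow> real) \<Rightarrow>
   ('n \<Rightarrow> real^'m \<Rightarrow> real) \<Rightarrow> real^'m \<Rightarrow> real^'m \<Rightarrow> ereal" where
  "Act g h C s r xk xp = objective g h C s r xk - objective g h C s r xp"

definition ratio ::
  "(real^'m \<Rightarrow> ereal) \<Rightarrow> (real^'d \<Rightarrow> real) \<Rightarrow> (real^'m \<Rightarrow> real^'d) \<Rightarrow> (real^'n \<Rightarrow> real) \<Rightarrow>
   ('n \<Rightarrow> real^'m \<Rightarrow> real) \<Rightarrow> real^'m^'m \<Rightarrow> real^'m \<Rightarrow> real^'m \<Rightarrow> ereal" where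
  "ratio g h C s r Q xk xp = Act g h C s r xk xp / Pred g h C s r Q xk xp"

definition terminates_at ::
  "(real^'m \<Rightarrow> ereal) \<Rightarrow> (real^'d \<Rightarrow> real) \<Rightarrow> (real^'m \<Rightarrow> real^'d) \<Rightarrow> (real^'n \<Rightarrow> real) \<Rightarrow>
   ('n \<Rightarrow> real^'m \<Rightarrow> real) \<Rightarrow> real \<Rightarrow> real^'m^'m \<Rightarrow> real^'m \<Rightarrow> real^'m \<Rightarrow> bool" where
  "terminates_at g h C s r eps Q xk xp \<longleftrightarrow>
     Pred g h C s r Q xk xp = 0 \<or> norm (Q *v (xk - xp)) \<le> eps"

text \<open>\<open>inner_loop \<dots> xk H mu mu' xp\<close>: the repeat loop at \<open>xk\<close> with block \<open>H\<close>, entered with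
  proximal parameter \<open>mu\<close>, ends by accepting the trial point \<open>xp\<close>, the parameter then being
  \<open>mu'\<close>. The relation has no instance when the loop triggers termination or runs forever.\<close>

inductive inner_loop ::
  "(real^'m \<Rightarrow> ereal) \<Rightarrow> (real^'d \<Rightarrow> real) \<Rightarrow> (real^'m \<Rightarrow> real^'d) \<Rightarrow> (real^'n \<Rightarrow> real) \<Rightarrow>
   ('n \<Rightarrow> real^'m \<Rightarrow> real) \<Rightarrow> real \<Rightarrow> real \<Rightarrow> real \<Rightarrow> real^'m \<Rightarrow> real^'m^'m \<Rightarrow>
   real \<Rightarrow> real \<Rightarrow> real^'m \<Rightarrow> bool"
  for g h C s r alpha1 nu_inc eps xk H where
  accept: "inner_loop g h C s r alpha1 nu_inc eps xk H mu mu xp"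
    if "is_trial g h C s r (prox_matrix mu H) xk xp"
       "\<not> terminates_at g h C s r eps (prox_matrix mu H) xk xp"
       "ratio g h C s r (prox_matrix mu H) xk xp \<ge> ereal alpha1"
| reject: "inner_loop g h C s r alpha1 nu_inc eps xk H mu mu' xp"
    if "is_trial g h C s r (prox_matrix mu H) xk xq"
       "\<not> terminates_at g h C s r eps (prox_matrix mu H) xk xq"
       "ratio g h C s r (prox_matrix mu H) xk xq < ereal alpha1"
       "inner_loop g h C s r alpha1 nu_inc eps xk H (nu_inc * mu) mu' xp"

text \<open>A run of the algorithm: \<open>mu k\<close> is the proximal parameter on entry to outer iteration \<open>k\<close>,
  \<open>S\<close> the set of accepted indices, and \<open>{..<k} \<subseteq> S\<close> says that iteration \<open>k\<close> is reached. The
  values of \<open>x\<close>, \<open>mu\<close> and \<open>H\<close> at iterations that are not reached are irrelevant.\<close>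

definition prox_convex_run ::
  "(real^'m \<Rightarrow> ereal) \<Rightarrow> (real^'d \<Rightarrow> real) \<Rightarrow> (real^'m \<Rightarrow> real^'d) \<Rightarrow> (real^'n \<Rightarrow> real) \<Rightarrow>
   ('n \<Rightarrow> real^'m \<Rightarrow> real) \<Rightarrow> real^'m \<Rightarrow> real \<Rightarrow> real \<Rightarrow> real \<Rightarrow> real \<Rightarrow> real \<Rightarrow> real \<Rightarrow> real \<Rightarrow>
   (nat \<Rightarrow> real^'m) \<Rightarrow> (nat \<Rightarrow> real) \<Rightarrow> (nat \<Rightarrow> real^'m^'m) \<Rightarrow> nat set \<Rightarrow> bool" where
  "prox_convex_run g h C s r x0 mu0 mu_min alpha1 alpha2 nu_inc nu_dec eps x mu H S \<longleftrightarrow>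
     x 0 = x0 \<and> mu 0 = mu0 \<and>
     (\<forall>k. {..<k} \<subseteq> S \<longrightarrow> H k \<in> curvature_blocks h C s r (x k)) \<and>
     (\<forall>k. k \<in> S \<longleftrightarrow> {..<k} \<subseteq> S \<and>
        (\<exists>mu' xp. inner_loop g h C s r alpha1 nu_inc eps (x k) (H k) (mu k) mu' xp)) \<and>
     (\<forall>k\<in>S. \<exists>mu'. inner_loop g h C s r alpha1 nu_inc eps (x k) (H k) (mu k) mu' (x (Suc k)) \<and>
        mu (Suc k) =
          (if ratio g h C s r (prox_matrix mu' (H k)) (x k) (x (Suc k)) > ereal alpha2
           then max mu_min (nu_dec * mu') else mu'))"

definition subseq_cluster_point :: "(nat \<Rightarrow> 'a::topological_space) \<Rightarrow> nat set \<Rightarrow> 'a \<Rightarrow> bool" where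
  "subseq_cluster_point x S xbar \<longleftrightarrow>
     (\<exists>\<sigma>. strict_mono \<sigma> \<and> range \<sigma> \<subseteq> S \<and> (\<lambda>i. x (\<sigma> i)) \<longlonglongrightarrow> xbar)"

end

theory Submission
  imports Defs
begin

text \<open>The trial point minimises the proximal model, so the minimal model value \<open>q k\<close>
  bounds the objective from below up to a quadratic error: the proximal model at \<open>u\<close> exceeds \<open>F u\<close> by
  at most a multiple \<open>K\<close> of the squared distance from \<open>u\<close> to \<open>x k\<close>. With \<open>p k\<close> the predicted
  decrease, that is, \<open>F (x k) - q k\<close>, this reads
  \<open>F (x k) - p k - K * (norm (u - x k))\<^sup>2 \<le> F u\<close> for all \<open>u\<close>.
  Accepted steps decrease \<open>F\<close> by at least \<open>alpha1 * p k\<close>, and \<open>F\<close> is bounded below, so \<open>p k\<close> tends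
  to \<open>0\<close>. Since \<open>F\<close> is lower semicontinuous, at a cluster point \<open>xbar\<close> the inequality becomes
  \<open>F xbar - K * (norm (u - xbar))\<^sup>2 \<le> F u\<close>, and this puts \<open>0\<close> even into the Frechet
  subdifferential (\<open>cluster_point_quadratic_minorant\<close>, \<open>frechet_subdiff_zeroI\<close>).

  What has to be shown is that one \<open>K\<close> serves all iterations. It is built from the lower model
  error \<open>LL\<close>, a bound for the proximal parameters and a bound for the curvature blocks.
  The proximal parameters are bounded because a step is rejected only if its parameter is
  below \<open>LU\<close> (\<open>rejected_parameter_less\<close>, \<open>inner_loop_outcome\<close>). The curvature blocks are bounded
  because the projection onto the positive semidefinite cone does not increase the Frobenius norm, and
  the projected matrices consist of subgradients of Lipschitz functions and of Hessians of functions
  with Lipschitz gradients (\<open>C_blocks_norm_le\<close>, \<open>s_blocks_norm_le\<close>). The constants in these two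
  bounds are crude; only their independence of the iteration matters.\<close>

section \<open>Subdifferentials\<close>

text \<open>The difference quotients at \<open>y\<close> are at least \<open>- K * norm (y - x)\<close>, which tends to \<open>0\<close>.\<close>

lemma frechet_subdiff_zeroI:
  fixes f :: "'a::real_inner \<Rightarrow> ereal"
  assumes fin: "\<bar>f x\<bar> \<noteq> \<infinity>"
    and minorant: "\<And>y. f x - ereal (K * (norm (y - x))\<^sup>2) \<le> f y"
  shows "0 \<in> frechet_subdiff f x"
proof -
  obtain a where a: "f x = ereal a" using fin by (cases "f x") auto
  have quot: "ereal (- K * norm (y - x)) \<le> (f y - f x - ereal (0 \<bullet> (y - x))) / ereal (norm (y - x))"
    if "y \<noteq> x" for y
  proof (cases "f y")
    case (real b)
    have "- K * (norm (y - x))\<^sup>2 \<le> b - a" using minorant[of y] a real by simp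
    then show ?thesis
      using that a real by (simp add: pos_le_divide_eq power2_eq_square mult.assoc)
  next
    case PInf then show ?thesis using a that by simp
  next
    case MInf then show ?thesis using a minorant[of y] by simp
  qed
  have "((\<lambda>y. ereal (- K * norm (y - x))) \<longlongrightarrow> ereal (- K * norm (x - x))) (at x)"
    by (intro tendsto_intros)
  then have lim: "((\<lambda>y. ereal (- K * norm (y - x))) \<longlongrightarrow> 0) (at x)"
    by (simp add: zero_ereal_def)
  have "\<forall>\<^sub>F y in at x. c < (f y - f x - ereal (0 \<bullet> (y - x))) / ereal (norm (y - x))" if "c < 0" for c
  proof -
    have "\<forall>\<^sub>F y in at x. y \<noteq> x" by (simp add: eventually_at_filter)
    with order_tendstoD(1)[OF lim that] show ?thesis
      by eventually_elim (use quot in \<open>blast intro: less_le_trans\<close>)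
  qed
  then show ?thesis using fin by (simp add: frechet_subdiff_def le_Liminf_iff)
qed

text \<open>Constant sequences are admissible in the limiting subdifferential.\<close>

lemma frechet_subset_limiting: "frechet_subdiff f x \<subseteq> limiting_subdiff f x"
proof
  fix v assume "v \<in> frechet_subdiff f x"
  then show "v \<in> limiting_subdiff f x"
    unfolding limiting_subdiff_def mem_Collect_eq
    by (intro conjI exI[of _ "\<lambda>_. x"] exI[of _ "\<lambda>_. v"] allI tendsto_const)
      (simp_all add: frechet_subdiff_def)
qed

lemma frechet_subdiff_norm_le_lipschitz:
  fixes f :: "'a::real_inner \<Rightarrow> real"
  assumes lip: "L-lipschitz_on UNIV f" and v: "v \<in> frechet_subdiff (\<lambda>z. ereal (f z)) x"
  shows "norm v \<le> L"
proof (rule ccontr)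
  assume "\<not> norm v \<le> L"
  then have less: "L < norm v" by simp
  have pos: "0 < norm v" using lipschitz_on_nonneg[OF lip] less by linarith
  let ?q = "\<lambda>y. (f y - f x - v \<bullet> (y - x)) / norm (y - x)"
  have lim: "0 \<le> Liminf (at x) (\<lambda>y. (ereal (f y) - ereal (f x) - ereal (v \<bullet> (y - x))) / ereal (norm (y - x)))"
    using v by (simp add: frechet_subdiff_def)
  have "ereal (L - norm v) < 0" using less by (simp add: zero_ereal_def)
  with lim have "\<forall>\<^sub>F y in at x. ereal (L - norm v) <
      (ereal (f y) - ereal (f x) - ereal (v \<bullet> (y - x))) / ereal (norm (y - x))"
    unfolding le_Liminf_iff by blast
  moreover have "\<forall>\<^sub>F y in at x. y \<noteq> x" by (simp add: eventually_at_filter)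
  ultimately have "\<forall>\<^sub>F y in at x. L - norm v < ?q y"
    by eventually_elim (simp add: pos_le_divide_eq)
  \<comment> \<open>Move from \<open>x\<close> in the direction \<open>v\<close>: the linear term grows at rate \<open>norm v\<close>, \<open>f\<close> at rate at most \<open>L\<close>.\<close>
  then obtain d where d: "0 < d" "\<And>y. y \<noteq> x \<Longrightarrow> dist y x < d \<Longrightarrow> L - norm v < ?q y"
    unfolding eventually_at by auto
  define t where "t = d / (2 * norm v)"
  have t: "0 < t" using d pos by (simp add: t_def)
  define y where "y = x + t *\<^sub>R v"
  have yx: "y - x = t *\<^sub>R v" by (simp add: y_def)
  have n: "norm (y - x) = t * norm v" using t by (simp add: yx)
  have "dist y x = d / 2" using pos n by (simp add: dist_norm t_def)
  moreover have "y \<noteq> x" using t pos by (auto simp: y_def)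
  ultimately have "L - norm v < ?q y" using d by simp
  then have "(L - norm v) * (t * norm v) < f y - f x - v \<bullet> (y - x)"
    using t pos by (simp add: n pos_less_divide_eq)
  moreover have "f y - f x \<le> L * (t * norm v)"
    using lipschitz_onD[OF lip, of y x] n by (simp add: dist_norm)
  moreover have "v \<bullet> (y - x) = t * (norm v * norm v)"
    by (simp add: yx dot_square_norm power2_eq_square)
  ultimately show False by (simp add: algebra_simps)
qed

text \<open>The bound for Frechet subgradients passes to limits. It controls the subgradients that may be
  chosen freely in the curvature blocks.\<close>

lemma limiting_subdiff_norm_le_lipschitz:
  fixes f :: "'a::real_inner \<Rightarrow> real"
  assumes lip: "L-lipschitz_on UNIV f" and v: "v \<in> limiting_subdiff (\<lambda>z. ereal (f z)) x"
  shows "norm v \<le> L"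
proof -
  obtain X V where V: "V \<longlonglongrightarrow> v" "\<forall>n. V n \<in> frechet_subdiff (\<lambda>z. ereal (f z)) (X n)"
    using v by (auto simp: limiting_subdiff_def)
  have "\<forall>n. norm (V n) \<le> L" using frechet_subdiff_norm_le_lipschitz[OF lip] V(2) by blast
  then show ?thesis using LIMSEQ_le_const2[OF tendsto_norm[OF V(1)]] by blast
qed

section \<open>Matrix norms and the positive semidefinite cone\<close>

lemma norm_matrix_vector_mult_le:
  fixes A :: "real^'n^'m"
  shows "norm (A *v v) \<le> norm A * norm v"
proof -
  have "norm (A *v v) \<le> L2_set (\<lambda>i. norm (A $ i) * norm v) UNIV"
    unfolding norm_vec_def[of "A *v v"]
    by (rule L2_set_mono) (auto simp: matrix_vector_mul_component Cauchy_Schwarz_ineq2)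
  also have "\<dots> = norm A * norm v"
    by (simp add: norm_vec_def[of A] L2_set_left_distrib)
  finally show ?thesis .
qed

lemma inner_matrix_vector_le:
  fixes A :: "real^'m^'m"
  shows "v \<bullet> (A *v v) \<le> norm A * (norm v)\<^sup>2"
proof -
  have "v \<bullet> (A *v v) \<le> norm v * (norm A * norm v)"
    by (rule order_trans[OF norm_cauchy_schwarz mult_left_mono[OF norm_matrix_vector_mult_le]]) simp
  then show ?thesis by (simp add: power2_eq_square mult_ac)
qed

text \<open>The norm here is the Frobenius norm, which sums the squares of all entries.\<close>

lemma norm_transpose: "norm (transpose A) = norm (A :: real^'n^'m)"
proof -
  have sq: "(norm B)\<^sup>2 = (\<Sum>i\<in>UNIV. \<Sum>j\<in>UNIV. (B $ i $ j)\<^sup>2)" for B :: "real^'c^'e"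
    by (simp add: norm_vec_def L2_set_def sum_nonneg)
  have "(norm (transpose A))\<^sup>2 = (norm A)\<^sup>2"
    unfolding sq transpose_def by (subst sum.swap) simp
  then show ?thesis by simp
qed

text \<open>Row \<open>i\<close> of \<open>A ** B\<close> is the image of row \<open>i\<close> of \<open>A\<close> under the transpose of \<open>B\<close>.\<close>

lemma norm_matrix_mult_le:
  fixes A :: "real^'n^'m" and B :: "real^'k^'n"
  shows "norm (A ** B) \<le> norm A * norm B"
proof -
  have row: "(A ** B) $ i = transpose B *v (A $ i)" for i
    by (simp add: vec_eq_iff matrix_matrix_mult_def matrix_vector_mult_def transpose_def mult.commute)
  have "norm (A ** B) \<le> L2_set (\<lambda>i. norm (A $ i) * norm B) UNIV"
    unfolding norm_vec_def[of "A ** B"] row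
  proof (rule L2_set_mono)
    show "norm (transpose B *v (A $ i)) \<le> norm (A $ i) * norm B" for i
      using norm_matrix_vector_mult_le[of "transpose B" "A $ i"]
      unfolding norm_transpose by (simp only: mult.commute)
  qed simp
  also have "\<dots> = norm A * norm B"
    by (simp add: norm_vec_def[of A] L2_set_left_distrib)
  finally show ?thesis .
qed

lemma row_eq_nth: "row i A = A $ i"
  by (simp add: row_def vec_nth_inverse)

lemma norm_matrix_le_sum_rows: "norm (A :: real^'n^'m) \<le> (\<Sum>i\<in>UNIV. norm (row i A))"
  unfolding norm_vec_def[of A] row_eq_nth by (simp add: L2_set_le_sum)

lemma norm_row_le_spectral_norm:
  fixes A :: "real^'m^'d"
  shows "norm (row j A) \<le> spectral_norm A"
proof -
  \<comment> \<open>Test the operator norm on the row itself.\<close>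
  let ?a = "A $ j"
  have "norm ?a * norm ?a = \<bar>(A *v ?a) $ j\<bar>"
    by (simp only: matrix_vector_mul_component dot_square_norm power2_eq_square abs_mult abs_norm_cancel)
  also have "\<dots> \<le> norm (A *v ?a)" by (rule component_le_norm_cart)
  also have "\<dots> \<le> spectral_norm A * norm ?a"
    unfolding spectral_norm_def by (rule onorm) (simp add: matrix_vector_mul_bounded_linear)
  finally have "norm ?a * norm ?a \<le> spectral_norm A * norm ?a" .
  moreover have "0 \<le> spectral_norm A"
    unfolding spectral_norm_def by (rule onorm_pos_le) (simp add: matrix_vector_mul_bounded_linear)
  ultimately have "norm ?a \<le> spectral_norm A"
    by (cases "norm ?a = 0") (simp_all add: mult_le_cancel_right)
  then show ?thesis by (simp add: row_eq_nth)
qed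

lemma closed_psd_cone: "closed (psd_cone :: (real^'m^'m) set)"
proof -
  have lin: "continuous_on UNIV (\<lambda>A::real^'m^'m. transpose A)"
    "continuous_on UNIV (\<lambda>A::real^'m^'m. v \<bullet> (A *v v))" for v
    unfolding transpose_def matrix_vector_mult_def by (intro continuous_intros)+
  show ?thesis
    unfolding psd_cone_def
    by (intro closed_Collect_conj closed_Collect_all closed_Collect_eq closed_Collect_le
        continuous_intros lin)
qed

lemma convex_psd_cone: "convex (psd_cone :: (real^'m^'m) set)"
  unfolding convex_def psd_cone_def
  by (auto simp: transpose_def vec_eq_iff matrix_vector_mult_add_rdistrib inner_add_right
      scaleR_matrix_vector_assoc[symmetric])

lemma zero_in_psd_cone: "0 \<in> psd_cone"
  by (simp add: psd_cone_def transpose_def vec_eq_iff)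

text \<open>The projection onto a closed convex set is nonexpansive, and it fixes \<open>0\<close>; so it does not
  increase the norm.\<close>

lemma closest_point_psd_cone:
  fixes A :: "real^'m^'m"
  shows "closest_point psd_cone A \<in> psd_cone" "norm (closest_point psd_cone A) \<le> norm A"
proof -
  have ne: "psd_cone \<noteq> ({} :: (real^'m^'m) set)" using zero_in_psd_cone by blast
  show "closest_point psd_cone A \<in> psd_cone"
    by (rule closest_point_in_set[OF closed_psd_cone ne])
  show "norm (closest_point psd_cone A) \<le> norm A"
    using closest_point_lipschitz[OF convex_psd_cone closed_psd_cone ne, of A 0]
    by (simp add: closest_point_self[OF zero_in_psd_cone])
qed

section \<open>Gradients, Jacobians and Hessians of maps with Lipschitz derivatives\<close>

lemma norm_derivative_le_lipschitz:
  fixes f :: "'a::real_normed_vector \<Rightarrow> 'b::real_normed_vector"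
  assumes lip: "L-lipschitz_on UNIV f" and D: "(f has_derivative D) (at x)"
  shows "norm (D v) \<le> L * norm v"
proof (cases "v = 0")
  case True
  then show ?thesis using has_derivative_linear[OF D] by (simp add: linear_0)
next
  case False
  have "norm (D v) / norm v \<le> L"
  proof (rule field_le_epsilon)
    fix e :: real assume "0 < e"
    then obtain d where d: "0 < d"
      "\<And>y. norm (y - x) < d \<Longrightarrow> norm (f y - f x - D (y - x)) \<le> e * norm (y - x)"
      using D[unfolded has_derivative_at_alt, THEN conjunct2, rule_format, of e] by blast
    define t where "t = d / (2 * norm v)"
    have t: "0 < t" "t * norm v < d" using False d(1) by (auto simp: t_def)
    let ?y = "x + t *\<^sub>R v"
    have n: "norm (?y - x) = t * norm v" using t by simp
    have "norm (?y - x) < d" using t(2) unfolding n .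
    from d(2)[OF this] have "norm (f ?y - f x - D (?y - x)) \<le> e * (t * norm v)" unfolding n .
    moreover have "norm (f ?y - f x) \<le> L * (t * norm v)"
      using lipschitz_onD[OF lip, of ?y x] unfolding dist_norm n by blast
    moreover have "norm (D (?y - x)) \<le> norm (f ?y - f x) + norm (f ?y - f x - D (?y - x))"
      by (metis add.commute norm_minus_commute norm_triangle_sub)
    moreover have "norm (D (?y - x)) = t * norm (D v)"
      using has_derivative_linear[OF D] t by (simp add: linear_scale)
    ultimately have "t * norm (D v) \<le> L * (t * norm v) + e * (t * norm v)" by linarith
    also have "\<dots> = t * ((L + e) * norm v)" by algebra
    finally have "norm (D v) \<le> (L + e) * norm v" using t(1) by (rule mult_left_le_imp_le)
    then show "norm (D v) / norm v \<le> L + e" using False by (simp add: pos_divide_le_eq)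
  qed
  then show ?thesis using False by (simp add: pos_divide_le_eq)
qed

text \<open>Every entry of the Jacobian is a component of a directional derivative along a unit vector, hence
  at most \<open>L\<close> in absolute value. The dimensional factors come from bounding the Frobenius norm by
  the sum of the entries.\<close>

lemma norm_jacobian_le_lipschitz:
  fixes f :: "real^'n \<Rightarrow> real^'m"
  assumes lip: "L-lipschitz_on UNIV f" and diff: "f differentiable at x"
  shows "norm (jacobian f (at x)) \<le> of_nat CARD('m) * (of_nat CARD('n) * L)"
proof -
  let ?J = "jacobian f (at x)"
  have D: "(f has_derivative (\<lambda>v. ?J *v v)) (at x)" by (rule jacobian_works[THEN iffD1, OF diff])
  have entry: "\<bar>?J $ i $ j\<bar> \<le> L" for i j
  proof -
    have "\<bar>?J $ i $ j\<bar> = \<bar>(?J *v axis j 1) $ i\<bar>" by (simp add: matrix_vector_mul_component inner_axis)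
    also have "\<dots> \<le> norm (?J *v axis j 1)" by (rule component_le_norm_cart)
    also have "\<dots> \<le> L" using norm_derivative_le_lipschitz[OF lip D, of "axis j 1"] by simp
    finally show ?thesis .
  qed
  have "norm (?J $ i) \<le> of_nat CARD('n) * L" for i
    using norm_le_l1_cart[of "?J $ i"] sum_bounded_above[of UNIV "\<lambda>j. \<bar>?J $ i $ j\<bar>" L] entry
    by (auto intro: order_trans)
  moreover have "norm ?J \<le> (\<Sum>i\<in>UNIV. norm (?J $ i))"
    unfolding norm_vec_def[of ?J] by (rule L2_set_le_sum) simp
  ultimately show ?thesis
    using sum_bounded_above[of UNIV "\<lambda>i. norm (?J $ i)" "of_nat CARD('n) * L"]
    by (auto intro: order_trans)
qed

lemma norm_hessian_le_lipschitz:
  fixes f :: "real^'m \<Rightarrow> real"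
  assumes "L-lipschitz_on UNIV (grad f)" "grad f differentiable at x"
  shows "norm (hessian f x) \<le> of_nat CARD('m) * (of_nat CARD('m) * L)"
  unfolding hessian_def using assms by (rule norm_jacobian_le_lipschitz)

lemma grad_eqI:
  assumes "(f has_derivative (\<lambda>v. v \<bullet> D)) (at x)"
  shows "grad f x = D"
proof -
  have uniq: "E = D" if "GDERIV f x :> E" for E
  proof -
    have "(\<lambda>v. v \<bullet> E) = (\<lambda>v. v \<bullet> D)"
      using has_derivative_unique[OF _ assms] that by (simp add: gderiv_def)
    then have "(E - D) \<bullet> E = (E - D) \<bullet> D" by metis
    then have "(E - D) \<bullet> (E - D) = 0" by (simp add: inner_diff_right)
    then show ?thesis by simp
  qed
  have "GDERIV f x :> D" using assms by (simp only: gderiv_def)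
  then show ?thesis unfolding grad_def by (rule the_equality) (rule uniq)
qed

text \<open>Expressing the gradient through the derivative at basis vectors makes it a linear function of the
  derivative, so that it inherits differentiability from it.\<close>

lemma grad_eq_sum_Basis:
  fixes f :: "'a::euclidean_space \<Rightarrow> real"
  assumes "(f has_derivative D) (at x)"
  shows "grad f x = (\<Sum>b\<in>Basis. D b *\<^sub>R b)"
proof (rule grad_eqI)
  have lin: "linear D" using assms by (rule has_derivative_linear)
  have "D v = v \<bullet> (\<Sum>b\<in>Basis. D b *\<^sub>R b)" for v
  proof -
    have "D v = D (\<Sum>b\<in>Basis. (v \<bullet> b) *\<^sub>R b)" by (simp add: euclidean_representation)
    also have "\<dots> = (\<Sum>b\<in>Basis. (v \<bullet> b) * D b)"
      using lin by (simp add: linear_sum linear_scale)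
    finally show ?thesis by (simp add: inner_sum_right mult.commute)
  qed
  then have "(\<lambda>v. v \<bullet> (\<Sum>b\<in>Basis. D b *\<^sub>R b)) = D" by (intro ext) (rule sym)
  then show "(f has_derivative (\<lambda>v. v \<bullet> (\<Sum>b\<in>Basis. D b *\<^sub>R b))) (at x)"
    by (rule ssubst) (rule assms)
qed

text \<open>The functional \<open>l\<close> covers two uses: a coordinate, for the components of a vector-valued map, and
  the identity, for a real-valued function.\<close>

lemma C2_on_imp_grad_differentiable:
  fixes f :: "'a::euclidean_space \<Rightarrow> 'b::real_normed_vector"
  assumes C2: "C2_on UNIV f" and l: "bounded_linear l"
  shows "grad (\<lambda>z. l (f z)) differentiable at x"
proof -
  obtain f' where f': "\<And>x. (f has_derivative blinfun_apply (f' x)) (at x)" and "C1_on UNIV f'"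
    using C2 unfolding C2_on_def by blast
  then obtain f'' where f'': "\<And>x. (f' has_derivative blinfun_apply (f'' x)) (at x)"
    unfolding C1_on_def by blast
  have eq: "grad (\<lambda>z. l (f z)) = (\<lambda>x. \<Sum>b\<in>Basis. l (f' x b) *\<^sub>R b)"
    by (rule ext) (rule grad_eq_sum_Basis[OF bounded_linear.has_derivative[OF l f']])
  have "((\<lambda>x. l (f' x b) *\<^sub>R b) has_derivative (\<lambda>v. l (f'' x v b) *\<^sub>R b)) (at x)" for b
    by (rule bounded_linear.has_derivative[OF bounded_linear_scaleR_left
        bounded_linear.has_derivative[OF l
          bounded_linear.has_derivative[OF blinfun.bounded_linear_left f'']]])
  then have "((\<lambda>x. \<Sum>b\<in>Basis. l (f' x b) *\<^sub>R b) has_derivative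
      (\<lambda>v. \<Sum>b\<in>Basis. l (f'' x v b) *\<^sub>R b)) (at x)"
    by (rule has_derivative_sum)
  then show ?thesis
    unfolding eq by (rule differentiableI)
qed

lemma grad_component_eq_row_jacobian:
  fixes f :: "real^'m \<Rightarrow> real^'d"
  assumes "f differentiable at x"
  shows "grad (\<lambda>z. f z $ j) x = row j (jacobian f (at x))"
proof (rule grad_eqI)
  have "(f has_derivative (\<lambda>v. jacobian f (at x) *v v)) (at x)"
    by (rule jacobian_works[THEN iffD1, OF assms])
  from bounded_linear.has_derivative[OF bounded_linear_vec_nth this, of j]
  show "((\<lambda>z. f z $ j) has_derivative (\<lambda>v. v \<bullet> row j (jacobian f (at x)))) (at x)"
    by (simp add: matrix_vector_mul_component inner_commute row_eq_nth)
qed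

text \<open>The gradient of a component is a row of the Jacobian, and the norm of a row is at most
  the spectral norm of the matrix.\<close>

lemma grad_component_lipschitz:
  fixes C :: "real^'m \<Rightarrow> real^'d"
  assumes C1: "C1_on UNIV C"
    and lip: "\<forall>u v. spectral_norm (jacobian C (at u) - jacobian C (at v)) \<le> beta * norm (u - v)"
  shows "beta-lipschitz_on UNIV (grad (\<lambda>z. C z $ j))"
proof (rule lipschitz_onI)
  have diff: "C differentiable at u" for u
    using C1 unfolding C1_on_def differentiable_def by blast
  fix u v :: "real^'m"
  have "dist (grad (\<lambda>z. C z $ j) u) (grad (\<lambda>z. C z $ j) v)
      = norm (row j (jacobian C (at u) - jacobian C (at v)))"
    by (simp only: grad_component_eq_row_jacobian[OF diff] dist_norm row_eq_nth vector_minus_component)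
  also have "\<dots> \<le> spectral_norm (jacobian C (at u) - jacobian C (at v))"
    by (rule norm_row_le_spectral_norm)
  also have "\<dots> \<le> beta * dist u v" using lip by (simp add: dist_norm)
  finally show "dist (grad (\<lambda>z. C z $ j) u) (grad (\<lambda>z. C z $ j) v) \<le> beta * dist u v" .
next
  \<comment> \<open>Two distinct points force \<open>beta\<close> to be nonnegative.\<close>
  let ?e = "axis undefined 1 :: real^'m"
  have "0 \<le> spectral_norm (jacobian C (at ?e) - jacobian C (at 0))"
    by (rule order_trans[OF norm_ge_zero norm_row_le_spectral_norm])
  also have "\<dots> \<le> beta * norm (?e - 0)" using lip by blast
  finally show "0 \<le> beta" by simp
qed

section \<open>Boundedness of the curvature blocks\<close>

text \<open>The weights are the coordinates of a subgradient of \<open>h\<close>, bounded by \<open>Lh\<close>; the Hessians are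
  Jacobians of Lipschitz gradients.\<close>

lemma C_blocks_norm_le:
  fixes C :: "real^'m \<Rightarrow> real^'d"
  assumes h: "Lh-lipschitz_on UNIV h" and C1: "C1_on UNIV C"
    and lip: "\<forall>u v. spectral_norm (jacobian C (at u) - jacobian C (at v)) \<le> beta * norm (u - v)"
    and HC: "HC \<in> C_blocks h C z"
  shows "norm HC \<le> of_nat CARD('d) * (Lh * (of_nat CARD('m) * (of_nat CARD('m) * beta)))"
    (is "_ \<le> _ * (Lh * ?b)")
proof -
  note grad_lip = grad_component_lipschitz[OF C1 lip]
  have nonneg: "0 \<le> Lh" "0 \<le> beta"
    using lipschitz_on_nonneg[OF h] lipschitz_on_nonneg[OF grad_lip] by auto
  consider "HC = 0" | y where "C2_on UNIV C" "y \<in> limiting_subdiff (\<lambda>z. ereal (h z)) (C z)"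
      "HC = (\<Sum>j\<in>UNIV. y $ j *\<^sub>R hessian (\<lambda>x. C x $ j) z)"
    using HC unfolding C_blocks_def by blast
  then show ?thesis
  proof cases
    case 1 then show ?thesis using nonneg by simp
  next
    case 2
    have y: "\<bar>y $ j\<bar> \<le> Lh" for j
      using component_le_norm_cart[of y j] limiting_subdiff_norm_le_lipschitz[OF h 2(2)] by linarith
    have hess: "norm (hessian (\<lambda>x. C x $ j) z) \<le> ?b" for j
      by (rule norm_hessian_le_lipschitz[OF grad_lip
            C2_on_imp_grad_differentiable[OF 2(1) bounded_linear_vec_nth]])
    have "norm HC \<le> (\<Sum>j\<in>(UNIV :: 'd set). Lh * ?b)"
      unfolding 2(3)
    proof (rule sum_norm_le)
      fix j
      show "norm (y $ j *\<^sub>R hessian (\<lambda>x. C x $ j) z) \<le> Lh * ?b"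
        unfolding norm_scaleR by (rule mult_mono[OF y hess nonneg(1)]) simp
    qed
    then show ?thesis by simp
  qed
qed

text \<open>The rows of \<open>G\<close> are subgradients of Lipschitz functions, and the Hessian of \<open>s\<close> is the Jacobian
  of a Lipschitz map. Only components with a negative weight contribute the remaining Hessians, which
  is why bounds on \<open>grad s\<close> and on the gradients of \<open>r i\<close> are asked for at those components alone.\<close>

lemma s_blocks_norm_le:
  fixes r :: "'n::finite \<Rightarrow> real^'m \<Rightarrow> real" and s :: "real^'n \<Rightarrow> real"
  assumes s: "betas-lipschitz_on UNIV (grad s)"
    and r: "\<And>i. (Lr i)-lipschitz_on UNIV (r i)"
    and neg: "\<And>i. grad s (Rmap r z) $ i < 0 \<Longrightarrow>
        \<bar>grad s (Rmap r z) $ i\<bar> \<le> Ls \<and> (betar i)-lipschitz_on UNIV (grad (r i))"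
    and Hs: "Hs \<in> s_blocks s r z"
  shows "norm Hs \<le> (\<Sum>i\<in>UNIV. Lr i) * (of_nat CARD('n) * (of_nat CARD('n) * betas)) * (\<Sum>i\<in>UNIV. Lr i)
    + (\<Sum>i\<in>UNIV. \<bar>Ls\<bar> * (of_nat CARD('m) * (of_nat CARD('m) * \<bar>betar i\<bar>)))"
    (is "_ \<le> ?l * ?b * ?l + (\<Sum>i\<in>UNIV. ?c i)")
proof -
  have nonneg: "0 \<le> Lr i" "0 \<le> betas" "0 \<le> ?c i" for i
    using lipschitz_on_nonneg[OF r] lipschitz_on_nonneg[OF s] by auto
  then have l: "0 \<le> ?l" by (simp add: sum_nonneg)
  consider "Hs = 0" | G J where "C2_on UNIV s"
      "\<forall>i. row i G \<in> limiting_subdiff (\<lambda>z. ereal (r i z)) z"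
      "J \<subseteq> {i. grad s (Rmap r z) $ i < 0 \<and> C2_on UNIV (r i)}"
      "Hs = transpose G ** hessian s (Rmap r z) ** G + (\<Sum>i\<in>J. grad s (Rmap r z) $ i *\<^sub>R hessian (r i) z)"
    using Hs unfolding s_blocks_def by blast
  then show ?thesis
  proof cases
    case 1
    then show ?thesis using nonneg l by (simp add: sum_nonneg)
  next
    case 2
    have G: "norm G \<le> ?l"
      by (rule order_trans[OF norm_matrix_le_sum_rows sum_mono])
        (use limiting_subdiff_norm_le_lipschitz[OF r] 2(2) in blast)
    have hs: "norm (hessian s (Rmap r z)) \<le> ?b"
      by (rule norm_hessian_le_lipschitz[OF s C2_on_imp_grad_differentiable[OF 2(1) bounded_linear_ident]])
    have "norm (transpose G ** hessian s (Rmap r z) ** G)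
        \<le> norm (transpose G ** hessian s (Rmap r z)) * norm G"
      by (rule norm_matrix_mult_le)
    also have "\<dots> \<le> (norm (transpose G) * norm (hessian s (Rmap r z))) * norm G"
      by (rule mult_right_mono[OF norm_matrix_mult_le]) simp
    also have "\<dots> \<le> ?l * ?b * ?l"
      unfolding norm_transpose by (intro mult_mono G hs mult_nonneg_nonneg l) (use nonneg in auto)
    finally have quad: "norm (transpose G ** hessian s (Rmap r z) ** G) \<le> ?l * ?b * ?l" .
    have "norm (\<Sum>i\<in>J. grad s (Rmap r z) $ i *\<^sub>R hessian (r i) z) \<le> (\<Sum>i\<in>J. ?c i)"
    proof (rule sum_norm_le)
      fix i assume "i \<in> J"
      then have i: "grad s (Rmap r z) $ i < 0" "C2_on UNIV (r i)" using 2(3) by auto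
      then have lip: "(betar i)-lipschitz_on UNIV (grad (r i))"
        and Ls: "\<bar>grad s (Rmap r z) $ i\<bar> \<le> \<bar>Ls\<bar>"
        using neg[OF i(1)] by auto
      have "norm (hessian (r i) z) \<le> of_nat CARD('m) * (of_nat CARD('m) * \<bar>betar i\<bar>)"
        using norm_hessian_le_lipschitz[OF lip C2_on_imp_grad_differentiable[OF i(2) bounded_linear_ident]]
          lipschitz_on_nonneg[OF lip] by simp
      then show "norm (grad s (Rmap r z) $ i *\<^sub>R hessian (r i) z) \<le> ?c i"
        unfolding norm_scaleR using Ls by (intro mult_mono) auto
    qed
    also have "\<dots> \<le> (\<Sum>i\<in>UNIV. ?c i)" by (rule sum_mono2) (use nonneg in auto)
    finally show ?thesis unfolding 2(4) using quad norm_triangle_le add_mono by blast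
  qed
qed

section \<open>Trial points, rejection and acceptance\<close>

lemma objective_domain_iff:
  assumes "proper_fun g"
  shows "u \<in> domain (objective g h C s r) \<longleftrightarrow> \<bar>g u\<bar> \<noteq> \<infinity>"
  using assms by (cases "g u") (auto simp: domain_def objective_def proper_fun_def)

lemma objective_model_real:
  assumes "proper_fun g" "u \<in> domain (objective g h C s r)"
  obtains a b where "objective g h C s r u = ereal a" "model g h C s r z u = ereal b"
  using assms by (cases "g u") (auto simp: objective_domain_iff objective_def model_def)

text \<open>The proximal model is exact at its centre; hence the minimal model value is at most the objective value there.\<close>

lemma prox_model_self: "prox_model g h C s r Q z z = objective g h C s r z"
proof -
  have "Phi s r z i z = 0" for i by (simp add: Phi_def)
  then show ?thesis by (simp add: prox_model_def model_def objective_def zero_ereal_def[symmetric])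
qed

lemma prox_matrix_quadratic:
  "v \<bullet> (prox_matrix mu H *v v) = mu * (norm v)\<^sup>2 + v \<bullet> (H *v v)"
  by (simp add: prox_matrix_def matrix_vector_mult_add_rdistrib inner_add_right
      scaleR_matrix_vector_assoc[symmetric] dot_square_norm)

text \<open>The minimal value \<open>q\<close> of the proximal model lies below the objective value at the centre, so it is
  finite, and then so is the objective at the minimiser. This turns all quantities of the algorithm
  into real numbers.\<close>

lemma trial_point:
  assumes g: "proper_fun g" and z: "z \<in> domain (objective g h C s r)"
    and trial: "is_trial g h C s r Q z p"
  obtains f_z f_p q where "p \<in> domain (objective g h C s r)"
    "objective g h C s r z = ereal f_z" "objective g h C s r p = ereal f_p"
    "prox_model g h C s r Q z p = ereal q" "q \<le> f_z" "\<And>u. ereal q \<le> prox_model g h C s r Q z u"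
proof -
  let ?P = "prox_model g h C s r Q z"
  have min: "?P p \<le> ?P u" for u
    using trial by (auto simp: is_trial_def is_arg_min_def not_less)
  obtain f_z where f_z: "objective g h C s r z = ereal f_z"
    using objective_model_real[OF g z] by metis
  then have le: "?P p \<le> ereal f_z" using min[of z] by (simp add: prox_model_self)
  have "\<bar>g p\<bar> \<noteq> \<infinity>"
    using le g by (cases "g p") (auto simp: prox_model_def model_def proper_fun_def)
  then have p: "p \<in> domain (objective g h C s r)" by (simp add: objective_domain_iff[OF g])
  obtain f_p b where f_p: "objective g h C s r p = ereal f_p" "model g h C s r z p = ereal b"
    using objective_model_real[OF g p] by blast
  then obtain q where q: "?P p = ereal q" by (simp add: prox_model_def)
  show ?thesis
    by (rule that[OF p f_z f_p(1) q]) (use le min q in auto)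
qed

text \<open>Once \<open>mu\<close> reaches the constant \<open>LU\<close> of the upper model error, the proximal model majorises the
  objective. The actual decrease is then at least the predicted one, and the step cannot be rejected.\<close>

lemma rejected_parameter_less:
  assumes g: "proper_fun g" and z: "z \<in> domain (objective g h C s r)"
    and trial: "is_trial g h C s r (prox_matrix mu H) z p"
    and pred: "Pred g h C s r (prox_matrix mu H) z p \<noteq> 0"
    and ratio: "ratio g h C s r (prox_matrix mu H) z p < ereal alpha" and alpha: "alpha \<le> 1"
    and upper: "\<And>u. u \<in> domain (objective g h C s r) \<Longrightarrow>
      objective g h C s r u - model g h C s r z u \<le> ereal (LU / 2 * (norm (u - z))\<^sup>2)"
    and H: "H \<in> psd_cone"
  shows "mu < LU"
proof (rule ccontr)
  assume "\<not> mu < LU"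
  obtain f_z f_p q where p: "p \<in> domain (objective g h C s r)"
    and F: "objective g h C s r z = ereal f_z" "objective g h C s r p = ereal f_p"
    and q: "prox_model g h C s r (prox_matrix mu H) z p = ereal q" "q \<le> f_z"
    using trial_point[OF g z trial] by metis
  obtain b where b: "model g h C s r z p = ereal b"
    using objective_model_real[OF g p] by metis
  \<comment> \<open>For \<open>LU \<le> mu\<close> the prox-term outweighs the model error, so that \<open>f_p \<le> q\<close>.\<close>
  define d where "d = (norm (p - z))\<^sup>2"
  define e where "e = (p - z) \<bullet> (H *v (p - z))"
  have "b + 1 / 2 * (mu * d + e) = q"
    using q(1) unfolding prox_model_def b prox_matrix_quadratic d_def e_def by simp
  then have "2 * q = 2 * b + mu * d + e" by (simp add: field_simps)
  moreover have "0 \<le> e" using H by (simp add: psd_cone_def e_def)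
  moreover have "2 * f_p \<le> 2 * b + LU * d" using upper[OF p] by (simp add: F b d_def)
  moreover have "LU * d \<le> mu * d"
    using \<open>\<not> mu < LU\<close> by (simp add: mult_right_mono d_def)
  ultimately have "f_p \<le> q" by linarith
  moreover have "q \<noteq> f_z" using pred by (simp add: Pred_def F q)
  moreover have "(f_z - f_p) / (f_z - q) < alpha"
    using ratio \<open>q \<noteq> f_z\<close> by (simp add: ratio_def Act_def Pred_def F q)
  moreover have "1 \<le> (f_z - f_p) / (f_z - q)" using calculation q(2) by simp
  ultimately show False using alpha by linarith
qed

lemma accepted_step:
  assumes g: "proper_fun g" and z: "z \<in> domain (objective g h C s r)"
    and trial: "is_trial g h C s r Q z p"
    and pred: "Pred g h C s r Q z p \<noteq> 0"
    and ratio: "ereal alpha \<le> ratio g h C s r Q z p"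
  obtains f_z f_p q where "p \<in> domain (objective g h C s r)"
    "objective g h C s r z = ereal f_z" "objective g h C s r p = ereal f_p"
    "q \<le> f_z" "\<And>u. ereal q \<le> prox_model g h C s r Q z u" "alpha * (f_z - q) \<le> f_z - f_p"
proof -
  obtain f_z f_p q where p: "p \<in> domain (objective g h C s r)"
    and F: "objective g h C s r z = ereal f_z" "objective g h C s r p = ereal f_p"
    and q: "prox_model g h C s r Q z p = ereal q" "q \<le> f_z"
      "\<And>u. ereal q \<le> prox_model g h C s r Q z u"
    using trial_point[OF g z trial] by blast
  have "q \<noteq> f_z" using pred by (auto simp: Pred_def F q)
  moreover have "alpha \<le> (f_z - f_p) / (f_z - q)"
    using ratio \<open>q \<noteq> f_z\<close> by (simp add: ratio_def Act_def Pred_def F q)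
  ultimately have "alpha * (f_z - q) \<le> f_z - f_p"
    using q(2) by (simp add: pos_le_divide_eq)
  then show ?thesis by (rule that[OF p F q(2,3)])
qed

text \<open>A parameter is increased only while it is below \<open>LU\<close>, so if it starts at or below a bound
  \<open>M\<close> with \<open>nu * LU \<le> M\<close>, it stays there.\<close>

lemma inner_loop_outcome:
  assumes loop: "inner_loop g h C s r alpha nu eps z H mu mu' p"
    and g: "proper_fun g" and z: "z \<in> domain (objective g h C s r)"
    and alpha: "alpha \<le> 1" and nu: "0 < nu"
    and upper: "\<And>u. u \<in> domain (objective g h C s r) \<Longrightarrow>
      objective g h C s r u - model g h C s r z u \<le> ereal (LU / 2 * (norm (u - z))\<^sup>2)"
    and H: "H \<in> psd_cone"
    and M: "mu \<le> M" "nu * LU \<le> M"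
  shows "mu' \<le> M \<and> is_trial g h C s r (prox_matrix mu' H) z p \<and>
    Pred g h C s r (prox_matrix mu' H) z p \<noteq> 0 \<and>
    ereal alpha \<le> ratio g h C s r (prox_matrix mu' H) z p"
  using loop M(1)
proof induction
  case (accept mu p)
  then show ?case by (simp add: terminates_at_def)
next
  case (reject mu q mu' p)
  have "mu < LU"
    using reject by (intro rejected_parameter_less[OF g z _ _ _ alpha upper H])
      (auto simp: terminates_at_def)
  then have "nu * mu \<le> M" using nu M(2) by (smt (verit) mult_left_mono)
  then show ?case by (rule reject.IH)
qed

section \<open>Stationarity of cluster points\<close>

lemma closed_fun_limit_le:
  assumes "closed_fun f" "X \<longlonglongrightarrow> x" "a \<longlonglongrightarrow> l" "\<And>n. f (X n) \<le> ereal (a n)"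
  shows "f x \<le> ereal l"
proof -
  have "(\<lambda>n. (X n, a n)) \<longlonglongrightarrow> (x, l)" by (intro tendsto_Pair assms)
  then have "(x, l) \<in> ereal_epigraph f"
    by (rule closed_sequentially[rotated -1])
      (use assms in \<open>simp_all add: closed_fun_def ereal_epigraph_def\<close>)
  then show ?thesis by (simp add: ereal_epigraph_def)
qed

text \<open>Suppose that \<open>F\<close> lies, up to a gap \<open>p k\<close>, above a downward parabola with vertex at \<open>x k\<close>,
  of a curvature independent of \<open>k\<close>. A decrease of \<open>F\<close> proportional to the gap forces the gaps to
  vanish, and in the limit lower semicontinuity gives an exact parabola below \<open>F\<close> that touches it at
  the cluster point.\<close>

lemma cluster_point_quadratic_minorant:
  fixes F :: "'a::real_inner \<Rightarrow> ereal" and f p :: "nat \<Rightarrow> real"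
  assumes closed: "closed_fun F"
    and F_x: "\<And>k. F (x k) = ereal (f k)"
    and bounded_below: "\<And>k. c \<le> f k"
    and p_nonneg: "\<And>k. 0 \<le> p k"
    and alpha: "0 < alpha"
    and decrease: "\<And>k. alpha * p k \<le> f k - f (Suc k)"
    and minorant: "\<And>k u. ereal (f k - p k - K * (norm (u - x k))\<^sup>2) \<le> F u"
    and \<sigma>: "strict_mono \<sigma>" "(\<lambda>i. x (\<sigma> i)) \<longlonglongrightarrow> xbar"
  shows "F xbar < \<infinity>" "F xbar - ereal (K * (norm (u - xbar))\<^sup>2) \<le> F u"
proof -
  have "f (Suc k) \<le> f k" for k
    using decrease[of k] mult_nonneg_nonneg[of alpha "p k"] alpha p_nonneg[of k] by linarith
  then have "decseq f" by (rule decseq_SucI)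
  then obtain l where l: "f \<longlonglongrightarrow> l"
    using decseq_convergent bounded_below by metis
  \<comment> \<open>Each gap \<open>p k\<close> is paid for by the decrease of the convergent sequence \<open>f\<close>.\<close>
  have "(\<lambda>k. (f k - f (Suc k)) / alpha) \<longlonglongrightarrow> (l - l) / alpha"
    using l alpha by (intro tendsto_intros LIMSEQ_Suc) auto
  then have "p \<longlonglongrightarrow> 0"
    using p_nonneg decrease alpha
    by (intro tendsto_sandwich[of "\<lambda>_. 0" p _ "\<lambda>k. (f k - f (Suc k)) / alpha"])
      (auto simp: field_simps)
  then have p\<sigma>: "(\<lambda>i. p (\<sigma> i)) \<longlonglongrightarrow> 0"
    using LIMSEQ_subseq_LIMSEQ[OF _ \<sigma>(1)] by (force simp: o_def)
  have f\<sigma>: "(\<lambda>i. f (\<sigma> i)) \<longlonglongrightarrow> l"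
    using LIMSEQ_subseq_LIMSEQ[OF l \<sigma>(1)] by (simp add: o_def)
  have Fl: "F xbar \<le> ereal l"
    using closed_fun_limit_le[OF closed \<sigma>(2) f\<sigma>] F_x by simp
  then show "F xbar < \<infinity>" by auto
  have lim: "(\<lambda>i. ereal (f (\<sigma> i) - p (\<sigma> i) - K * (norm (u - x (\<sigma> i)))\<^sup>2))
      \<longlonglongrightarrow> ereal (l - 0 - K * (norm (u - xbar))\<^sup>2)"
    by (intro tendsto_intros f\<sigma> p\<sigma> \<sigma>)
  have "F xbar - ereal (K * (norm (u - xbar))\<^sup>2) \<le> ereal (l - K * (norm (u - xbar))\<^sup>2)"
    using Fl by (cases "F xbar") auto
  also have "\<dots> \<le> F u"
    using LIMSEQ_le_const2[OF lim] minorant by simp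
  finally show "F xbar - ereal (K * (norm (u - xbar))\<^sup>2) \<le> F u" .
qed

theorem theorem3p4:
  fixes g :: "real^'m \<Rightarrow> ereal" and h :: "real^'d \<Rightarrow> real" and C :: "real^'m \<Rightarrow> real^'d"
    and s :: "real^'n \<Rightarrow> real" and r :: "'n \<Rightarrow> real^'m \<Rightarrow> real"
    and F :: "real^'m \<Rightarrow> ereal" and X0 :: "(real^'m) set" and x0 :: "real^'m"
    and Lh betaC betas Ls LR betaR LU LL :: real and Lr :: "real^'n" and betar :: "'n \<Rightarrow> real"
    and Ineg :: "'n set"
    and mu0 mu_min alpha1 alpha2 nu_inc nu_dec eps :: real
    and x :: "nat \<Rightarrow> real^'m" and mu :: "nat \<Rightarrow> real" and H :: "nat \<Rightarrow> real^'m^'m" and S :: "nat set"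
  assumes F_eq: "F = objective g h C s r"
    and g: "proper_fun g" "closed_fun g" "convex_fun g"
    and h: "closed (epigraph UNIV h)" "convex_on UNIV h"
    and C: "C1_on UNIV C"
    and s: "C1_on UNIV s"
    and r: "\<And>i. closed (epigraph UNIV (r i))" "\<And>i. convex_on UNIV (r i)"
    and monotone_or_smooth:
      "\<forall>xb\<in>domain F. \<exists>W. open W \<and> Rmap r xb \<in> W \<and>
         (\<forall>i. \<not> (\<exists>U. open U \<and> xb \<in> U \<and> C1_on U (r i)) \<longrightarrow> (\<forall>z\<in>W. 0 \<le> grad s z $ i))"
    and X0_eq: "X0 = sublevel F x0"
    and x0: "x0 \<in> domain F"
    and X0: "X0 \<noteq> {}" "compact X0"
    and h_Lipschitz: "Lh-lipschitz_on UNIV h"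
    and C_Lipschitz: "\<forall>u v. spectral_norm (jacobian C (at u) - jacobian C (at v)) \<le> betaC * norm (u - v)"
    and s_Lipschitz: "betas-lipschitz_on UNIV (grad s)"
    and r_Lipschitz: "\<forall>i. (Lr $ i)-lipschitz_on UNIV (r i)"
    and LR_eq: "LR = norm Lr"
    and Ineg_eq: "Ineg = neg_indices g h C s r x0"
    and Ineg_nonempty: "Ineg \<noteq> {} \<longrightarrow>
      (\<forall>y \<in> Rmap r ` {u. F u \<le> F x0}. norm (grad s y) \<le> Ls) \<and>
      (\<forall>i\<in>Ineg. C1_on UNIV (r i) \<and> (betar i)-lipschitz_on UNIV (grad (r i)))"
    and betaR_eq: "betaR = sqrt (\<Sum>i\<in>Ineg. (betar i)\<^sup>2)"
    and LU_eq: "LU = Lh * betaC + LR\<^sup>2 * betas"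
    and LL_eq: "LL = LU + Ls * betaR"
    and params: "0 < mu0" "0 < mu_min" "0 < alpha1" "alpha1 < alpha2" "alpha2 < 1"
      "1 < nu_inc" "0 < nu_dec" "nu_dec < 1" "0 \<le> eps"
    and run: "prox_convex_run g h C s r x0 mu0 mu_min alpha1 alpha2 nu_inc nu_dec eps x mu H S"
    and F: "proper_fun F" "closed_fun F" "\<exists>c::real. \<forall>u. ereal c \<le> F u"
    and iterates_bounded: "bounded (x ` S)"
    and model_bounds: "\<forall>k\<in>S. \<forall>u\<in>domain F.
      ereal (- (LL / 2) * (norm (u - x k))\<^sup>2) \<le> F u - model g h C s r (x k) u \<and>
      F u - model g h C s r (x k) u \<le> ereal (LU / 2 * (norm (u - x k))\<^sup>2)"
  shows "\<forall>xbar. subseq_cluster_point x S xbar \<longrightarrow> 0 \<in> limiting_subdiff F xbar"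
proof (intro allI impI)
  fix xbar assume "subseq_cluster_point x S xbar"
  then obtain \<sigma> where \<sigma>: "strict_mono \<sigma>" "range \<sigma> \<subseteq> S" "(\<lambda>i. x (\<sigma> i)) \<longlonglongrightarrow> xbar"
    unfolding subseq_cluster_point_def by blast
  have prefix: "{..<k} \<subseteq> S" if "k \<in> S" for k
    using run that unfolding prox_convex_run_def by blast
  \<comment> \<open>A cluster point requires infinitely many accepted indices, and these form an initial segment.\<close>
  have S: "k \<in> S" for k
  proof -
    have "k < \<sigma> (Suc k)" using seq_suble[OF \<sigma>(1), of "Suc k"] by simp
    then show ?thesis using prefix[of "\<sigma> (Suc k)"] \<sigma>(2) by auto
  qed
  have start: "x 0 = x0" "mu 0 = mu0"
    and block: "\<And>k. H k \<in> curvature_blocks h C s r (x k)"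
    using run S unfolding prox_convex_run_def by blast+
  obtain mu' where loop:
      "\<And>k. inner_loop g h C s r alpha1 nu_inc eps (x k) (H k) (mu k) (mu' k) (x (Suc k))"
    and mu_Suc: "\<And>k. mu (Suc k) =
      (if ratio g h C s r (prox_matrix (mu' k) (H k)) (x k) (x (Suc k)) > ereal alpha2
       then max mu_min (nu_dec * mu' k) else mu' k)"
    using run S unfolding prox_convex_run_def by metis
  note bounds = model_bounds[rule_format, OF S, unfolded F_eq]

  have psd: "H k \<in> psd_cone" for k
    using block[of k] by (auto simp: curvature_blocks_def closest_point_psd_cone(1))

  \<comment> \<open>\<open>M\<close> bounds all proximal parameters: it dominates the initial value, the floor used after very
    successful steps, and one increase from below \<open>LU\<close>.\<close>
  define M where "M = max mu0 (max mu_min (nu_inc * LU))"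
  have M: "mu0 \<le> M" "mu_min \<le> M" "nu_inc * LU \<le> M" "0 \<le> M"
    using params by (auto simp: M_def)
  have outcome: "mu' k \<le> M \<and> is_trial g h C s r (prox_matrix (mu' k) (H k)) (x k) (x (Suc k)) \<and>
      Pred g h C s r (prox_matrix (mu' k) (H k)) (x k) (x (Suc k)) \<noteq> 0 \<and>
      ereal alpha1 \<le> ratio g h C s r (prox_matrix (mu' k) (H k)) (x k) (x (Suc k))"
    if "x k \<in> domain F" "mu k \<le> M" for k
    using params bounds that
    by (intro inner_loop_outcome[OF loop g(1) _ _ _ _ psd _ M(3)]) (auto simp: F_eq)
  have step: "x (Suc k) \<in> domain F \<and> F (x (Suc k)) \<le> F (x k) \<and> mu (Suc k) \<le> M"
    if "x k \<in> domain F" "mu k \<le> M" for k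
  proof -
    note dom = that(1)[unfolded F_eq] and o = outcome[OF that]
    obtain f_z f_p q where *: "x (Suc k) \<in> domain F" "F (x k) = ereal f_z" "F (x (Suc k)) = ereal f_p"
        "q \<le> f_z" "alpha1 * (f_z - q) \<le> f_z - f_p"
      using accepted_step[OF g(1) dom] o unfolding F_eq by metis
    have "0 \<le> alpha1 * (f_z - q)" using params *(4) by simp
    then have "f_p \<le> f_z" using *(5) by linarith
    moreover have "nu_dec * mu' k \<le> M"
    proof -
      have "nu_dec * mu' k \<le> nu_dec * M" using o params by (simp add: mult_left_mono)
      also have "\<dots> \<le> M" using params M(4) by (simp add: mult_left_le_one_le)
      finally show ?thesis .
    qed
    ultimately show ?thesis using * o M(2) by (simp add: mu_Suc)
  qed
  have inv: "x k \<in> domain F \<and> F (x k) \<le> F x0 \<and> mu k \<le> M" for k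
  proof (induction k)
    case 0 then show ?case using x0 M(1) by (simp add: start)
  next
    case (Suc k) then show ?case using step order_trans by blast
  qed

  \<comment> \<open>Every iterate stays in the sublevel set of \<open>x0\<close>, where negative weights come with indices in \<open>Ineg\<close>.\<close>
  obtain B where B: "\<And>k. norm (H k) \<le> B"
  proof -
    have neg: "\<bar>grad s (Rmap r (x k)) $ i\<bar> \<le> Ls \<and> (betar i)-lipschitz_on UNIV (grad (r i))"
      if "grad s (Rmap r (x k)) $ i < 0" for k i
    proof -
      have "i \<in> Ineg"
        using that inv[of k] unfolding Ineg_eq neg_indices_def sublevel_def F_eq by blast
      then have "norm (grad s (Rmap r (x k))) \<le> Ls" "(betar i)-lipschitz_on UNIV (grad (r i))"
        using Ineg_nonempty inv[of k] by auto
      then show ?thesis using component_le_norm_cart[of "grad s (Rmap r (x k))" i] by linarith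
    qed
    obtain BC where BC: "\<And>HC k. HC \<in> C_blocks h C (x k) \<Longrightarrow> norm HC \<le> BC"
      using C_blocks_norm_le[OF h_Lipschitz C C_Lipschitz] by blast
    obtain Bs where Bs: "\<And>Hs k. Hs \<in> s_blocks s r (x k) \<Longrightarrow> norm Hs \<le> Bs"
      using s_blocks_norm_le[OF s_Lipschitz r_Lipschitz[rule_format] neg] by blast
    show ?thesis
    proof (rule that)
      fix k
      obtain HC Hs where H: "H k = closest_point psd_cone (HC + Hs)"
          "HC \<in> C_blocks h C (x k)" "Hs \<in> s_blocks s r (x k)"
        using block[of k] unfolding curvature_blocks_def by blast
      have "norm (HC + Hs) \<le> BC + Bs"
        by (rule norm_triangle_le[OF add_mono[OF BC[OF H(2)] Bs[OF H(3)]]])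
      then show "norm (H k) \<le> BC + Bs"
        unfolding H(1) by (rule order_trans[OF closest_point_psd_cone(2)])
    qed
  qed

  define f where "f k = real_of_ereal (F (x k))" for k
  have "\<exists>q. F (x k) = ereal (f k) \<and> q \<le> f k \<and> alpha1 * (f k - q) \<le> f k - f (Suc k) \<and>
      (\<forall>u. ereal q \<le> prox_model g h C s r (prox_matrix (mu' k) (H k)) (x k) u)" for k
  proof -
    obtain f_z f_p q where *: "F (x k) = ereal f_z" "F (x (Suc k)) = ereal f_p" "q \<le> f_z"
        "\<And>u. ereal q \<le> prox_model g h C s r (prox_matrix (mu' k) (H k)) (x k) u"
        "alpha1 * (f_z - q) \<le> f_z - f_p"
      using accepted_step[OF g(1)] outcome inv[of k] unfolding F_eq by metis
    then show ?thesis by (auto simp: f_def)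
  qed
  then obtain q where F_x: "\<And>k. F (x k) = ereal (f k)" and q_le: "\<And>k. q k \<le> f k"
    and decrease: "\<And>k. alpha1 * (f k - q k) \<le> f k - f (Suc k)"
    and q_min: "\<And>k u. ereal (q k) \<le> prox_model g h C s r (prox_matrix (mu' k) (H k)) (x k) u"
    by metis

  \<comment> \<open>The curvature of the model error and of the prox-term, added up.\<close>
  define K where "K = (LL + M + B) / 2"
  have minorant: "ereal (f k - (f k - q k) - K * (norm (u - x k))\<^sup>2) \<le> F u" for k u
  proof (cases "u \<in> domain F")
    case False then show ?thesis by (simp add: domain_def)
  next
    case True
    obtain a b where ab: "F u = ereal a" "model g h C s r (x k) u = ereal b"
      using objective_model_real[OF g(1)] True unfolding F_eq by metis
    define d where "d = (norm (u - x k))\<^sup>2"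
    have "q k \<le> b + 1 / 2 * (mu' k * d + (u - x k) \<bullet> (H k *v (u - x k)))"
      using q_min[of k u] unfolding prox_model_def prox_matrix_quadratic ab d_def by simp
    then have "2 * q k \<le> 2 * b + mu' k * d + (u - x k) \<bullet> (H k *v (u - x k))"
      by (simp add: field_simps)
    moreover have "(u - x k) \<bullet> (H k *v (u - x k)) \<le> B * d"
      using inner_matrix_vector_le[of "u - x k" "H k"] mult_right_mono[OF B[of k], of d]
      by (simp add: d_def)
    moreover have "mu' k * d \<le> M * d"
      using outcome[of k] inv[of k] by (simp add: d_def mult_right_mono)
    moreover have "2 * b \<le> 2 * a + LL * d"
      using bounds[of u k] True by (simp add: F_eq[symmetric] ab d_def)
    ultimately have "2 * q k \<le> 2 * a + LL * d + M * d + B * d" by linarith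
    then have "q k - K * d \<le> a" by (simp add: K_def field_simps)
    then show ?thesis by (simp add: ab d_def)
  qed
  obtain c where c: "\<And>u. ereal c \<le> F u" using F(3) by blast
  have c_le: "c \<le> f k" for k using c[of "x k"] by (simp add: F_x)
  note limit = cluster_point_quadratic_minorant[OF F(2) F_x c_le _ params(3) decrease minorant \<sigma>(1,3)]
  have "\<bar>F xbar\<bar> \<noteq> \<infinity>" using limit(1) q_le c[of xbar] by auto
  then have "0 \<in> frechet_subdiff F xbar"
    by (rule frechet_subdiff_zeroI) (rule limit(2), use q_le in simp)
  then show "0 \<in> limiting_subdiff F xbar" using frechet_subset_limiting by blast
qed
end
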